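(* Let $(T_n)_{n\ge 0}$ be the Tribonacci sequence. Consider the equation $T_n-2^x3^y=0$ in nonnegative integers $n,x,y$ with $n=0$ or $n\ge 2$. This equation has exactly five solutions, namely $$(n,x,y)\in\{(2,0,0),(3,1,0),(4,2,0),(7,3,1),(9,0,4)\},$$ i.e. $0=T_2-2^03^0=T_3-2^13^0=T_4-2^23^0=T_7-2^33^1=T_9-2^03^4$.
   Context: The Tribonacci numbers are defined by $T_0=0$, $T_1=T_2=1$ and $T_{m+3}=T_{m+2}+T_{m+1}+T_m$ for all $m\ge 0$. The index $n=1$ is excluded throughout (since $T_1=T_2$), so $n$ ranges over $\{0\}\cup\{n\in\mathbb{Z}:n\ge 2\}$. *)

theory Defs
  imports Main
begin

text \<open>The values are integers rather than naturals so that the subtraction in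
  \<open>T\<^sub>n - 2\<^sup>x3\<^sup>y = 0\<close> is not truncated.\<close>

fun trib :: "nat \<Rightarrow> int" where
  "trib 0 = 0"
| "trib (Suc 0) = 1"
| "trib (Suc (Suc 0)) = 1"
| "trib (Suc (Suc (Suc m))) = trib (Suc (Suc m)) + trib (Suc m) + trib m"

end

theory Submission imports Defs "HOL-Computational_Algebra.Primes" begin

text \<open>Extended to negative indices, the Tribonacci sequence vanishes at \<open>0\<close>, \<open>-1\<close>, \<open>-4\<close>, \<open>-17\<close>. For
  \<open>p = 2\<close> and \<open>p = 3\<close>, a high power of \<open>p\<close> divides \<open>T\<^sub>n\<close> only if \<open>n\<close> is \<open>p\<close>-adically close to one of
  these zeros \<open>-a\<close>, and near \<open>-a\<close> the sequence is \<open>p\<close>-adically linear, so the power is bounded by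
  a constant multiple of \<open>n + a\<close>. Hence \<open>2\<^sup>x3\<^sup>y = T\<^sub>n\<close> is at most quadratic in \<open>n\<close>, whereas \<open>T\<^sub>n\<close>
  grows exponentially, which leaves only \<open>n < 22\<close>.\<close>

section \<open>Sequences satisfying the Tribonacci recurrence\<close>

definition trib_rec :: "(nat \<Rightarrow> int) \<Rightarrow> bool" where
  "trib_rec f \<longleftrightarrow> (\<forall>n. f (n + 3) = f (n + 2) + f (n + 1) + f n)"

lemma trib_rec_trib: "trib_rec trib"
  by (simp add: trib_rec_def numeral_3_eq_3 numeral_2_eq_2)

lemma trib_rec_shift: "trib_rec f \<Longrightarrow> trib_rec (\<lambda>n. f (n + m))"
  unfolding trib_rec_def
proof
  fix n assume "\<forall>n. f (n + 3) = f (n + 2) + f (n + 1) + f n"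
  from this[rule_format, of "n + m"]
  show "f (n + 3 + m) = f (n + 2 + m) + f (n + 1 + m) + f (n + m)"
    by (simp add: ac_simps)
qed

lemma trib_rec_diff: "trib_rec f \<Longrightarrow> trib_rec g \<Longrightarrow> trib_rec (\<lambda>n. f n - g n)"
  unfolding trib_rec_def by simp

lemma trib_rec_div:
  assumes "trib_rec f" "\<And>n. q dvd f n"
  shows "trib_rec (\<lambda>n. f n div q)"
  using assms by (simp add: trib_rec_def)

text \<open>All three coefficients satisfy the recurrence in \<open>m\<close>, so three base cases
  suffice; the offset 3 keeps the indices of \<open>trib\<close> nonnegative.\<close>

lemma trib_rec_add:
  assumes "trib_rec f"
  shows "f (n + (m + 3)) =
    trib (m + 1) * f n + (trib (m + 1) + trib m) * f (n + 1) + trib (m + 2) * f (n + 2)"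
proof (induction m rule: trib.induct)
  case 1
  show ?case using assms by (simp add: trib_rec_def numeral_2_eq_2)
next
  case 2
  show ?case
    using assms[unfolded trib_rec_def, rule_format, of n]
      assms[unfolded trib_rec_def, rule_format, of "n + 1"]
    by (simp add: numeral_2_eq_2 numeral_3_eq_3)
next
  case 3
  show ?case
    using assms[unfolded trib_rec_def, rule_format, of n]
      assms[unfolded trib_rec_def, rule_format, of "n + 1"]
      assms[unfolded trib_rec_def, rule_format, of "n + 2"]
    by (simp add: numeral_2_eq_2 numeral_3_eq_3)
next
  case (4 m)
  have "f (n + (Suc (Suc (Suc m)) + 3)) =
      f (n + (Suc (Suc m) + 3)) + f (n + (Suc m + 3)) + f (n + (m + 3))"
    using assms[unfolded trib_rec_def, rule_format, of "n + m + 3"]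
    by (simp add: numeral_2_eq_2 numeral_3_eq_3)
  then show ?case
    unfolding 4 by (simp add: numeral_2_eq_2 algebra_simps)
qed

section \<open>Periods modulo q and p-adic linearity\<close>

text \<open>Quantifying over all \<open>f\<close> makes a period applicable to shifts and to
  quotients of differences.\<close>

definition trib_period :: "nat \<Rightarrow> int \<Rightarrow> bool" where
  "trib_period P q \<longleftrightarrow> (\<forall>f. trib_rec f \<longrightarrow> (\<forall>n. q dvd f (n + P) - f n))"

text \<open>The residues -1, 1, 0 are the values at -3, -2, -1 of the extended sequence; they reduce
  the combination in \<open>trib_rec_add\<close> to \<open>f n\<close>.\<close>

lemma trib_periodI:
  assumes "trib m mod q = - 1 mod q" "trib (m + 1) mod q = 1 mod q" "trib (m + 2) mod q = 0"
  shows "trib_period (m + 3) q"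
  unfolding trib_period_def
proof (intro allI impI)
  fix f :: "nat \<Rightarrow> int" and n assume "trib_rec f"
  then have "f (n + (m + 3)) - f n = (trib (m + 1) - 1) * (f n + f (n + 1))
      + (trib m - (- 1)) * f (n + 1) + trib (m + 2) * f (n + 2)"
    using trib_rec_add[of f n m] by (simp add: algebra_simps)
  moreover have "q dvd trib (m + 1) - 1" "q dvd trib m - (- 1)" "q dvd trib (m + 2)"
    using assms by (simp_all only: mod_eq_dvd_iff mod_eq_0_iff_dvd)
  ultimately show "q dvd f (n + (m + 3)) - f n"
    by (simp only: dvd_add dvd_mult2)
qed

lemma trib_period_mult:
  assumes "trib_period P q" "trib_rec f"
  shows "q dvd f (n + m * P) - f n"
proof (induction m)
  case (Suc m)
  have "q dvd f (n + m * P + P) - f (n + m * P)"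
    using assms by (simp add: trib_period_def)
  from dvd_add[OF this Suc] show ?case by (simp add: ac_simps)
qed simp

text \<open>The differences over \<open>P\<close>, divided by \<open>q\<close>, satisfy the
  recurrence again and so have period \<open>P\<close> modulo \<open>q\<close>. Hence successive
  steps of length \<open>P\<close> add the same amount modulo \<open>q\<^sup>2\<close>.\<close>

lemma trib_period_linear:
  assumes per: "trib_period P q" and rec: "trib_rec f" and "q \<noteq> 0"
  shows "q\<^sup>2 dvd f (n + m * P) - f n - int m * (f (n + P) - f n)"
proof -
  define h where "h n = (f (n + P) - f n) div q" for n
  have h: "f (n + P) - f n = q * h n" for n
    using per rec by (simp add: trib_period_def h_def)
  have "trib_rec h"
    unfolding h_def using per rec
    by (intro trib_rec_div trib_rec_diff trib_rec_shift) (simp_all add: trib_period_def)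
  then have "q dvd h (n + m * P) - h n" for m
    by (rule trib_period_mult[OF per])
  then have step: "q\<^sup>2 dvd q * h (n + m * P) - q * h n" for m
    by (simp add: power2_eq_square flip: right_diff_distrib)
  show ?thesis
  proof (induction m)
    case (Suc m)
    from dvd_add[OF Suc step[of m, folded h]] show ?case
      by (simp add: algebra_simps)
  qed simp
qed

text \<open>Taking \<open>p\<close> steps multiplies the difference by \<open>p\<close>, up to the
  square of the modulus; since \<open>p\<close> divides \<open>q\<close>, that square contains a
  further factor \<open>p\<close>.\<close>

lemma trib_period_power:
  assumes per: "trib_period P q" and "int p dvd q" "q > 0"
  shows "trib_period (p ^ k * P) (int p ^ k * q)"
proof (induction k)
  case (Suc k)
  have "p > 0" using assms by (cases p) auto
  show ?case unfolding trib_period_def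
  proof (intro allI impI)
    fix f :: "nat \<Rightarrow> int" and n assume rec: "trib_rec f"
    let ?q = "int p ^ k * q"
    have "?q\<^sup>2 dvd f (n + p * (p ^ k * P)) - f n - int p * (f (n + p ^ k * P) - f n)"
      using trib_period_linear[OF Suc rec] \<open>p > 0\<close> \<open>q > 0\<close> by simp
    moreover have "int p * ?q dvd ?q\<^sup>2"
      using \<open>int p dvd q\<close> by (simp add: power2_eq_square mult_dvd_mono)
    ultimately have "int p * ?q dvd f (n + p * (p ^ k * P)) - f n - int p * (f (n + p ^ k * P) - f n)"
      by (rule dvd_trans[rotated])
    moreover have "int p * ?q dvd int p * (f (n + p ^ k * P) - f n)"
      using Suc rec by (simp add: trib_period_def)
    ultimately have "int p * ?q dvd f (n + p * (p ^ k * P)) - f n"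
      by (metis dvd_add_right_iff diff_add_cancel add.commute)
    then show "int p ^ Suc k * q dvd f (n + p ^ Suc k * P) - f n"
      by (simp add: ac_simps)
  qed
qed (use assms in simp)

text \<open>Passing from \<open>k\<close> to \<open>Suc k\<close> multiplies the difference by
  \<open>p\<close> with an error divisible by \<open>(p ^ k * q)\<^sup>2\<close>. The extra factor
  \<open>p\<close> serves the step from \<open>k = 0\<close>, where this is only
  \<open>q\<^sup>2\<close>.\<close>

lemma trib_period_power_linear:
  assumes per: "trib_period P q" and rec: "trib_rec f" and "int p dvd q" "q > 0"
  shows "int p ^ k * q\<^sup>2 dvd int p * (f (n + p ^ k * P) - f n - int p ^ k * (f (n + P) - f n))"
proof (induction k)
  case (Suc k)
  have "p > 0" using assms by (cases p) auto
  let ?q = "int p ^ k * q" and ?M = "int p ^ Suc k * q\<^sup>2"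
  define d d0 d1 where "d = f (n + P) - f n" "d0 = f (n + p ^ k * P) - f n" "d1 = f (n + p ^ Suc k * P) - f n"
  have "?q\<^sup>2 dvd d1 - int p * d0"
    using trib_period_linear[OF trib_period_power[OF per, of p k] rec, of n p] assms \<open>p > 0\<close>
    by (simp add: d_d0_d1_def mult.assoc)
  then have "int p * ?q\<^sup>2 dvd int p * (d1 - int p * d0)"
    by (rule mult_dvd_mono[OF dvd_refl])
  moreover have "?M dvd int p * ?q\<^sup>2"
    by (simp add: power_mult_distrib power2_eq_square mult_dvd_mono)
  ultimately have "?M dvd int p * (d1 - int p * d0)"
    by (rule dvd_trans[rotated])
  moreover have "?M dvd int p * (int p * (d0 - int p ^ k * d))"
    using mult_dvd_mono[OF dvd_refl[of "int p"] Suc]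
    by (simp add: d_d0_d1_def ac_simps)
  ultimately have "?M dvd int p * (d1 - int p * d0) + int p * (int p * (d0 - int p ^ k * d))"
    by (rule dvd_add)
  also have "\<dots> = int p * (d1 - int p ^ Suc k * d)"
    by (simp add: algebra_simps)
  finally show ?case
    by (simp add: d_d0_d1_def)
qed simp

section \<open>Valuation near a zero\<close>

text \<open>Write N = P p^k m with p not dividing m. By linearity p f(N) is congruent to p^(k+1) m
  f(P) modulo p^(k+2e), which is nonzero by \<open>ndvd\<close>. So x + 1 < k + 2e, while p^k \<le>
  N / P.\<close>

lemma trib_zero_valuation:
  fixes f :: "nat \<Rightarrow> int"
  assumes p: "prime p" and "e > 0" and per: "trib_period P (int p ^ e)" and rec: "trib_rec f"
    and f0: "f 0 = 0" and ndvd: "\<not> int p ^ (2 * e) dvd int p * f P"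
    and N: "N > 0" "P dvd N" "int p ^ x dvd f N"
  shows "p ^ 2 * P * p ^ x \<le> p ^ (2 * e) * N"
proof -
  obtain M where M: "N = P * M" using N by blast
  have "P > 0" "M > 0" using M N by auto
  obtain k m where km: "M = p ^ k * m" "\<not> p dvd m"
    using multiplicity_decompose'[of M p] p \<open>M > 0\<close>
    by (metis multiplicity_decompose not_prime_unit bot_nat_0.not_eq_extremum)
  let ?q = "int p ^ e"
  have q: "int p dvd ?q" "?q > 0"
    using \<open>e > 0\<close> prime_gt_0_nat[OF p] by simp_all
  define L where "L = int p ^ k * ?q\<^sup>2"
  have "(int p ^ k * ?q)\<^sup>2 dvd f N - int m * f (p ^ k * P)"
    using trib_period_linear[OF trib_period_power[OF per q, of k] rec, of 0 m] q prime_gt_0_nat[OF p]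
    by (simp add: M km f0 ac_simps)
  moreover have "L dvd (int p ^ k * ?q)\<^sup>2"
    by (simp add: L_def power_mult_distrib power2_eq_square mult_dvd_mono)
  ultimately have 1: "L dvd int p * (f N - int m * f (p ^ k * P))"
    by (meson dvd_trans dvd_mult)
  have 2: "L dvd int p * (f (p ^ k * P) - int p ^ k * f P)"
    using trib_period_power_linear[OF per rec q, of k 0] by (simp add: f0 L_def)
  have "\<not> L dvd int p * f N"
  proof
    assume "L dvd int p * f N"
    then have "L dvd int p * f N - int p * (f N - int m * f (p ^ k * P))
        - int m * (int p * (f (p ^ k * P) - int p ^ k * f P))"
      using 1 2 by (meson dvd_diff dvd_mult)
    also have "\<dots> = int p ^ k * (int m * (int p * f P))"
      by (simp add: algebra_simps)
    finally have "?q\<^sup>2 dvd int m * (int p * f P)"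
      using prime_gt_0_nat[OF p] by (simp add: L_def)
    moreover have "coprime (?q\<^sup>2) (int m)"
      using p km(2) by (simp add: prime_imp_coprime)
    ultimately have "?q\<^sup>2 dvd int p * f P"
      by (simp add: coprime_dvd_mult_right_iff)
    with ndvd show False by (simp add: power_mult mult.commute[of 2])
  qed
  moreover have "int p ^ Suc x dvd int p * f N"
    using N(3) by simp
  moreover have L: "L = int p ^ (k + 2 * e)"
    by (simp add: L_def power_add power_mult mult.commute[of 2])
  ultimately have "Suc x < k + 2 * e"
    by (metis le_imp_power_dvd dvd_trans not_less)
  then have "p ^ (x + 2) \<le> p ^ (k + 2 * e)"
    using prime_gt_0_nat[OF p] by (intro power_increasing) auto
  moreover have "p ^ k \<le> M" using km \<open>M > 0\<close> by (cases m) auto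
  then have "p ^ (k + 2 * e) \<le> p ^ (2 * e) * M"
    by (simp add: power_add)
  ultimately have "p ^ (x + 2) * P \<le> p ^ (2 * e) * M * P"
    using mult_le_mono1 order_trans by blast
  then show ?thesis by (simp add: M power_add power2_eq_square ac_simps)
qed


section \<open>Evaluation of terms\<close>

text \<open>Carrying a window of three residues makes evaluation linear in the index, unlike the
  triple recursion of \<open>trib\<close>.\<close>

fun trib_iter :: "int \<Rightarrow> nat \<Rightarrow> int \<Rightarrow> int \<Rightarrow> int \<Rightarrow> int" where
  "trib_iter M 0 a b c = a mod M"
| "trib_iter M (Suc n) a b c = trib_iter M n b c ((a + b + c) mod M)"

lemma trib_add_3_mod:
  "(trib r mod M + trib (r + 1) mod M + trib (r + 2) mod M) mod M = trib (r + 3) mod M"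
proof -
  have "(trib r mod M + trib (r + 1) mod M + trib (r + 2) mod M) mod M
      = (trib r + trib (r + 1) + trib (r + 2)) mod M"
    by (intro mod_add_cong mod_mod_trivial)
  also have "trib r + trib (r + 1) + trib (r + 2) = trib (r + 3)"
    using trib_rec_trib[unfolded trib_rec_def, rule_format, of r] by linarith
  finally show ?thesis .
qed

lemma trib_iter_trib:
  "trib_iter M n (trib r mod M) (trib (r + 1) mod M) (trib (r + 2) mod M) = trib (r + n) mod M"
proof (induction n arbitrary: r)
  case (Suc n)
  have "r + 1 + 1 = r + 2" "r + 1 + 2 = r + 3" "r + 1 + n = r + Suc n"
    by simp_all
  with Suc[of "r + 1"] show ?case
    by (simp only: trib_iter.simps trib_add_3_mod)
qed simp

lemma trib_mod_eq: "trib n mod M = trib_iter M n (0 mod M) (1 mod M) (1 mod M)"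
  using trib_iter_trib[of M n 0] by (simp add: numeral_2_eq_2)

text \<open>The modulus \<open>0\<close> gives exact values.\<close>

lemma trib_eq: "trib n = trib_iter 0 n 0 1 1"
  using trib_mod_eq[of n 0] by simp

lemma trib_values:
  "trib 2 = 1"
  "trib 3 = 2"
  "trib 4 = 4"
  "trib 5 = 7"
  "trib 6 = 13"
  "trib 7 = 24"
  "trib 8 = 44"
  "trib 9 = 81"
  "trib 10 = 149"
  "trib 11 = 274"
  "trib 12 = 504"
  "trib 13 = 927"
  "trib 14 = 1705"
  "trib 15 = 3136"
  "trib 16 = 5768"
  "trib 17 = 10609"
  "trib 18 = 19513"
  "trib 19 = 35890"
  "trib 20 = 66012"
  "trib 21 = 121415"
  "trib 22 = 223317"
  "trib 23 = 410744"
  "trib 24 = 755476"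
  unfolding trib_eq by code_simp+

section \<open>Zeros at negative indices\<close>

text \<open>\<open>back_trib n\<close> is \<open>T\<^sub>n\<^sub>-\<^sub>1\<^sub>7\<close>: the sequence extended to negative indices has the zeros
  \<open>0\<close>, \<open>-1\<close>, \<open>-4\<close>, \<open>-17\<close>.\<close>

fun back_trib :: "nat \<Rightarrow> int" where
  "back_trib 0 = 0"
| "back_trib (Suc 0) = 56"
| "back_trib (Suc (Suc 0)) = -47"
| "back_trib (Suc (Suc (Suc m))) = back_trib (Suc (Suc m)) + back_trib (Suc m) + back_trib m"

lemma trib_rec_back_trib: "trib_rec back_trib"
  by (simp add: trib_rec_def numeral_3_eq_3 numeral_2_eq_2)

lemma back_trib_add_3:
  "back_trib (m + 3) = 56 * (trib (m + 1) + trib m) - 47 * trib (m + 2)"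
  using trib_rec_add[OF trib_rec_back_trib, of 0 m] by (simp add: numeral_2_eq_2)

lemma back_trib_zeros: "b \<in> {0, 13, 16, 17} \<Longrightarrow> back_trib b = 0"
  using back_trib_add_3[of 10] back_trib_add_3[of 13] back_trib_add_3[of 14]
  by (auto simp: trib_values)

lemma back_trib_eq: "back_trib (n + 17) = trib n"
proof (induction n rule: trib.induct)
  case 2
  show ?case using back_trib_add_3[of 15] by (simp add: trib_values)
next
  case 3
  show ?case using back_trib_add_3[of 16] by (simp add: trib_values)
next
  case (4 m)
  have "back_trib (Suc (Suc (Suc m)) + 17)
      = back_trib (Suc (Suc m) + 17) + back_trib (Suc m + 17) + back_trib (m + 17)"
    unfolding add_Suc by (rule back_trib.simps)
  then show ?case unfolding 4 by simp
qed (simp add: back_trib_zeros)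

text \<open>This is \<open>trib_zero_valuation\<close> at the zero b - 17, with N = n + 17 - b.
  Adding \<open>P\<close> first keeps \<open>P + b - 17\<close> from being truncated.\<close>

lemma power_dvd_trib_bound:
  assumes "prime p" "e > 0" "trib_period P (int p ^ e)" "P \<ge> 17" "b \<in> {0, 13, 16, 17}"
    and "\<not> int p ^ (2 * e) dvd int p * trib (P + b - 17)"
    and "n > 0" "n mod P = (P + b - 17) mod P" "int p ^ x dvd trib n"
  shows "p ^ 2 * P * p ^ x \<le> p ^ (2 * e) * (n + 17)"
proof -
  have "b \<le> 17" using assms by auto
  have "(n + 17) mod P = (P + b - 17 + 17) mod P"
    by (intro mod_add_cong assms refl)
  also have "\<dots> = b mod P"
    using \<open>P \<ge> 17\<close> by simp
  finally have "P dvd n + 17 - b"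
    using \<open>b \<le> 17\<close> by (simp add: mod_eq_dvd_iff_nat)
  have "p ^ 2 * P * p ^ x \<le> p ^ (2 * e) * (n + 17 - b)"
  proof (rule trib_zero_valuation)
    show "trib_rec (\<lambda>m. back_trib (m + b))"
      by (intro trib_rec_shift trib_rec_back_trib)
    show "\<not> int p ^ (2 * e) dvd int p * back_trib (P + b)"
      using assms back_trib_eq[of "P + b - 17"] by simp
    show "int p ^ x dvd back_trib (n + 17 - b + b)"
      using assms \<open>b \<le> 17\<close> by (simp add: back_trib_eq)
  qed (use assms \<open>b \<le> 17\<close> \<open>P dvd n + 17 - b\<close> back_trib_zeros in auto)
  also have "\<dots> \<le> p ^ (2 * e) * (n + 17)" by simp
  finally show ?thesis .
qed

section \<open>Residue classes away from the zeros\<close>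

lemma mod_eq_imp_mod_dvd_eq:
  fixes a b :: int
  shows "a mod m = b \<Longrightarrow> d dvd m \<Longrightarrow> a mod d = b mod d"
  using mod_mod_cancel by metis

text \<open>Here 19683 = 3^9. The indices 1036, 1049, 1052, 1053 are the four
  \<open>1053 + b - 17\<close>; 1050 to 1052 yield the period, and 1053 to 1055 start the
  sweep.\<close>

lemma trib_values_mod:
  "trib 1036 mod 19683 = 6561"
  "trib 1049 mod 19683 = 13122"
  "trib 1050 mod 19683 = 10691"
  "trib 1051 mod 19683 = 19198"
  "trib 1052 mod 19683 = 3645"
  "trib 1053 mod 19683 = 13851"
  "trib 1054 mod 19683 = 17011"
  "trib 1055 mod 19683 = 14824"
  unfolding trib_mod_eq by code_simp+

lemma trib_period_32: "trib_period 32 16"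
proof -
  have "trib (29 + 1) mod 16 = 1" "trib 29 mod 16 = 15" "trib (29 + 2) mod 16 = 0"
    unfolding trib_mod_eq by code_simp+
  then have "trib_period (29 + 3) 16"
    by (intro trib_periodI) simp_all
  then show ?thesis by simp
qed

lemma trib_period_1053: "trib_period 1053 243"
proof -
  have "trib 1050 mod 243 = 242" "trib 1051 mod 243 = 1" "trib 1052 mod 243 = 0"
    using trib_values_mod(3,4,5)[THEN mod_eq_imp_mod_dvd_eq, of 243] by simp_all
  then have "trib_period (1050 + 3) 243"
    by (intro trib_periodI) simp_all
  then show ?thesis by simp
qed

text \<open>Divisibility by 16 depends only on n mod 32; the exempt residues are those of 0, -17,
  -4, -1.\<close>

lemma trib_not_dvd_16:
  assumes "n mod 32 \<notin> {0, 15, 28, 31}"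
  shows "\<not> 16 dvd trib n"
proof -
  have "\<forall>r\<in>set [0..<32]. r \<in> {0, 15, 28, 31} \<or> trib_iter 16 r (0 mod 16) (1 mod 16) (1 mod 16) \<noteq> 0"
    by code_simp
  moreover have "n mod 32 \<in> set [0..<32]"
    by simp
  ultimately have "trib (n mod 32) mod 16 \<noteq> 0"
    unfolding trib_mod_eq using assms by blast
  moreover have "16 dvd trib n - trib (n mod 32)"
    using trib_period_mult[OF trib_period_32 trib_rec_trib, of "n mod 32" "n div 32"] by simp
  ultimately show ?thesis by presburger
qed

text \<open>By linearity modulo \<open>243\<^sup>2\<close>, if \<open>3\<^sup>j\<close> with \<open>j \<le> 10\<close> divides \<open>u - a\<close> but not \<open>a\<close>, where \<open>a\<close> and
  \<open>u\<close> are the values at \<open>r\<close> and \<open>r + 1053\<close>, then \<open>3\<^sup>j\<close> divides no value at an index congruent to \<open>r\<close>.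
  For \<open>j = 5\<close> the first condition is automatic.\<close>

definition nonzero_class :: "int \<Rightarrow> int \<Rightarrow> bool" where
  "nonzero_class a u \<longleftrightarrow> a mod 243 \<noteq> 0 \<or> a mod 729 \<noteq> 0 \<and> u mod 729 = a mod 729
     \<or> a mod 6561 \<noteq> 0 \<and> u mod 6561 = a mod 6561"

lemma nonzero_class_mod: "nonzero_class (a mod 6561) (u mod 6561) \<longleftrightarrow> nonzero_class a u"
  by (simp add: nonzero_class_def mod_mod_cancel)

text \<open>The first argument counts the remaining indices, so the exempt \<open>n\<close> are \<open>1052 - r\<close> for the residues
  \<open>r\<close> of the four zeros.\<close>

fun sweep :: "nat \<Rightarrow> int \<Rightarrow> int \<Rightarrow> int \<Rightarrow> int \<Rightarrow> int \<Rightarrow> int \<Rightarrow> bool" where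
  "sweep 0 a b c u v w \<longleftrightarrow> True"
| "sweep (Suc n) a b c u v w \<longleftrightarrow>
    (if nonzero_class a u \<or> n \<in> {0, 3, 16, 1052}
     then sweep n b c ((a + b + c) mod 6561) v w ((u + v + w) mod 6561) else False)"

text \<open>The two windows advance in lockstep: when they stand at \<open>r + i\<close> and
  \<open>s + i\<close>, the remaining count is \<open>n - Suc i\<close>.\<close>

lemma sweep_trib:
  assumes "sweep n (trib r mod 6561) (trib (r + 1) mod 6561) (trib (r + 2) mod 6561)
      (trib s mod 6561) (trib (s + 1) mod 6561) (trib (s + 2) mod 6561)"
    and "i < n"
  shows "nonzero_class (trib (r + i)) (trib (s + i)) \<or> n - Suc i \<in> {0, 3, 16, 1052}"
  using assms
proof (induction n arbitrary: r s i)
  case (Suc n)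
  from Suc.prems(1) have head: "nonzero_class (trib r) (trib s) \<or> n \<in> {0, 3, 16, 1052}"
    and "sweep n (trib (r + 1) mod 6561) (trib (r + 2) mod 6561) (trib (r + 3) mod 6561)
      (trib (s + 1) mod 6561) (trib (s + 2) mod 6561) (trib (s + 3) mod 6561)"
    unfolding sweep.simps nonzero_class_mod trib_add_3_mod by (simp_all only: split: if_splits)
  moreover have "t + 1 + 1 = t + 2" "t + 1 + 2 = t + 3" for t :: nat
    by simp_all
  ultimately have tail: "sweep n
      (trib (r + 1) mod 6561) (trib (r + 1 + 1) mod 6561) (trib (r + 1 + 2) mod 6561)
      (trib (s + 1) mod 6561) (trib (s + 1 + 1) mod 6561) (trib (s + 1 + 2) mod 6561)"
    by (simp only:)
  show ?case
  proof (cases i)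
    case 0
    with head show ?thesis by simp
  next
    case (Suc j)
    with Suc.IH[OF tail, of j] Suc.prems(2) show ?thesis by simp
  qed
qed simp

lemma trib_nonzero_class:
  assumes "r < 1053" "r \<notin> {0, 1036, 1049, 1052}"
  shows "nonzero_class (trib r) (trib (r + 1053))"
proof -
  \<comment> \<open>The start values are T_0, T_1, T_2 and T_1053, T_1054, T_1055 modulo
    6561.\<close>
  have "sweep 1053 0 1 1 729 3889 1702"
    by code_simp
  moreover have "trib (1053 + 1) mod 6561 = 3889" "trib (1053 + 2) mod 6561 = 1702" "trib 1053 mod 6561 = 729"
    using trib_values_mod(6,7,8)[THEN mod_eq_imp_mod_dvd_eq, of 6561] by simp_all
  ultimately have "sweep 1053 (trib 0 mod 6561) (trib (0 + 1) mod 6561) (trib (0 + 2) mod 6561)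
      (trib 1053 mod 6561) (trib (1053 + 1) mod 6561) (trib (1053 + 2) mod 6561)"
    by (simp add: trib_values)
  from sweep_trib[OF this assms(1)] assms show ?thesis
    by (auto simp: ac_simps)
qed

lemma trib_not_dvd_6561:
  assumes "n mod 1053 \<notin> {0, 1036, 1049, 1052}"
  shows "\<not> 6561 dvd trib n"
proof
  assume dvd: "6561 dvd trib n"
  define a u where "a = trib (n mod 1053)" and "u = trib (n mod 1053 + 1053)"
  define k where "k = int (n div 1053) * (u - a)"
  have lin: "59049 dvd trib n - a - k"
    using trib_period_linear[OF trib_period_1053 trib_rec_trib, of "n mod 1053" "n div 1053"]
    by (simp add: a_def u_def k_def)
  \<comment> \<open>Modulo such \<open>d\<close>, which divides 59049 = 243^2, the value 0 = T_n is
    \<open>a + k\<close>, and \<open>k\<close> is a multiple of \<open>u - a\<close>.\<close>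
  have *: "d dvd a" if "d dvd u - a" "d dvd 6561" for d
  proof -
    have "d dvd 59049" using that(2) by (rule dvd_trans) simp
    then have "d dvd trib n - a - k"
      using lin by (rule dvd_trans)
    moreover have "d dvd trib n" using that(2) dvd by (rule dvd_trans)
    moreover have "d dvd k" using that(1) by (simp add: k_def)
    ultimately have "d dvd trib n - k - (trib n - a - k)"
      by (meson dvd_diff)
    then show ?thesis by simp
  qed
  have "nonzero_class a u"
    unfolding a_def u_def using assms by (intro trib_nonzero_class) auto
  moreover have "243 dvd u - a"
    using trib_period_1053 trib_rec_trib by (simp add: trib_period_def a_def u_def)
  ultimately show False
    using *[of 243] *[of 729] *[of 6561]
    by (auto simp: nonzero_class_def mod_eq_dvd_iff mod_eq_0_iff_dvd)
qed

section \<open>Bounds on the two prime powers and on n\<close>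

text \<open>Near a zero the factor is 2^8 / (4 * 32) = 2; elsewhere 2^x \<le> 8.\<close>

lemma power2_dvd_trib_bound:
  assumes "n > 0" "2 ^ x dvd trib n"
  shows "2 ^ x \<le> 2 * (n + 17)"
proof (cases "n mod 32 \<in> {0, 15, 28, 31}")
  case True
  \<comment> \<open>\<open>b + 15\<close> represents the zero b - 17 modulo 32.\<close>
  then have "\<exists>b\<in>{0, 13, 16, 17}. n mod 32 = (b + 15) mod 32"
    by (elim insertE emptyE) simp_all
  then obtain b where b: "b \<in> {0, 13, 16, 17}" "n mod 32 = (b + 15) mod 32"
    by blast
  have "4 * 32 * 2 ^ x \<le> 2 ^ (2 * 4) * (n + 17)"
  proof -
    \<comment> \<open>128 is 2^8 / 2, and the indices are the four
      \<open>32 + b - 17\<close>.\<close>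
    have "trib 15 mod 128 \<noteq> 0" "trib 28 mod 128 \<noteq> 0" "trib 31 mod 128 \<noteq> 0" "trib 32 mod 128 \<noteq> 0"
      unfolding trib_mod_eq by code_simp+
    then have "\<not> 128 dvd trib (32 + b - 17)"
      using b(1) by (auto simp: mod_eq_0_iff_dvd)
    then have "\<not> int 2 ^ (2 * 4) dvd int 2 * trib (32 + b - 17)"
      using dvd_mult_cancel_left[of 2 128 "trib (32 + b - 17)"] by simp
    moreover have "n mod 32 = (32 + b - 17) mod 32"
      using b(2) by (simp add: add.commute)
    ultimately show ?thesis
      using power_dvd_trib_bound[of 2 4 32 b n x] assms b trib_period_32 by simp
  qed
  then show ?thesis by simp
next
  case False
  have "x < 4"
  proof (rule ccontr)
    assume "\<not> x < 4"
    then have "(2::int) ^ 4 dvd 2 ^ x" by (intro le_imp_power_dvd) simp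
    with assms(2) have "(2::int) ^ 4 dvd trib n" by (rule dvd_trans[rotated])
    with trib_not_dvd_16[OF False] show False by simp
  qed
  then have "(2::nat) ^ x \<le> 2 ^ 3" by (intro power_increasing) auto
  then show ?thesis by simp
qed

text \<open>Near a zero the factor is 3^10 / (9 * 1053) < 7; elsewhere 3^y \<le> 3^7 = 2187. The sum
  covers both cases.\<close>

lemma power3_dvd_trib_bound:
  assumes "n > 0" "3 ^ y dvd trib n"
  shows "3 ^ y \<le> 2187 + 7 * (n + 17)"
proof (cases "n mod 1053 \<in> {0, 1036, 1049, 1052}")
  case True
  then have "\<exists>b\<in>{0, 13, 16, 17}. n mod 1053 = (b + 1036) mod 1053"
    by (elim insertE emptyE) simp_all
  then obtain b where b: "b \<in> {0, 13, 16, 17}" "n mod 1053 = (b + 1036) mod 1053"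
    by blast
  have "9 * 1053 * 3 ^ y \<le> 3 ^ (2 * 5) * (n + 17)"
  proof -
    have "\<not> 19683 dvd trib (1053 + b - 17)"
      using b(1) by (elim insertE emptyE) (simp_all add: dvd_eq_mod_eq_0 trib_values_mod)
    then have "\<not> int 3 ^ (2 * 5) dvd int 3 * trib (1053 + b - 17)"
      using dvd_mult_cancel_left[of 3 19683 "trib (1053 + b - 17)"] by simp
    moreover have "n mod 1053 = (1053 + b - 17) mod 1053"
      using b(2) by (simp add: add.commute)
    ultimately show ?thesis
      using power_dvd_trib_bound[of 3 5 1053 b n y] assms b trib_period_1053 by simp
  qed
  then show ?thesis by simp
next
  case False
  have "y < 8"
  proof (rule ccontr)
    assume "\<not> y < 8"
    then have "(3::int) ^ 8 dvd 3 ^ y" by (intro le_imp_power_dvd) simp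
    with assms(2) have "(3::int) ^ 8 dvd trib n" by (rule dvd_trans[rotated])
    with trib_not_dvd_6561[OF False] show False by simp
  qed
  then have "(3::nat) ^ y \<le> 3 ^ 7" by (intro power_increasing) auto
  then show ?thesis by simp
qed

text \<open>With n = m + 22, m + 39 is n + 17, so the left side is the product of the two bounds.
  The inequality would fail at n = 21.\<close>

lemma trib_growth: "2 * (int m + 39) * (2187 + 7 * (int m + 39)) < trib (m + 22)"
proof (induction m rule: trib.induct)
  case (4 m)
  have "trib (Suc (Suc (Suc m)) + 22) = trib (Suc (Suc m) + 22) + trib (Suc m + 22) + trib (m + 22)"
    unfolding add_Suc by (rule trib.simps)
  moreover have "0 \<le> int m * int m" by simp
  ultimately show ?case
    using 4 unfolding of_nat_Suc ring_distribs by linarith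
qed (simp_all add: trib_values)

lemma trib_smooth_bound:
  assumes "trib n = 2 ^ x * 3 ^ y"
  shows "n < 22"
proof (rule ccontr)
  assume "\<not> n < 22"
  then obtain m where m: "n = m + 22"
    by (metis add.commute le_Suc_ex not_less)
  have "(2::nat) ^ x \<le> 2 * (n + 17)" "(3::nat) ^ y \<le> 2187 + 7 * (n + 17)"
    by (rule power2_dvd_trib_bound power3_dvd_trib_bound; use assms m in simp)+
  then have "(2::nat) ^ x * 3 ^ y \<le> 2 * (n + 17) * (2187 + 7 * (n + 17))"
    by (rule mult_le_mono)
  then have "int (2 ^ x * 3 ^ y) \<le> int (2 * (n + 17) * (2187 + 7 * (n + 17)))"
    by (simp only: of_nat_le_iff)
  with trib_growth[of m] assms m show False by (simp add: ac_simps)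
qed

section \<open>The remaining small indices\<close>

lemma coprime_6_dvd_smooth:
  assumes "d dvd 2 ^ x * 3 ^ y" "coprime d (6 :: int)"
  shows "is_unit d"
proof -
  have "coprime d 2" "coprime d 3"
    using assms(2) coprime_mult_right_iff[of d 2 3] by simp_all
  then have "coprime d (2 ^ x * 3 ^ y)" by simp
  from coprime_common_divisor[OF this dvd_refl assms(1)] show ?thesis .
qed

lemma smooth_small_cases:
  assumes "2 ^ x * 3 ^ y = (N :: int)" "N \<le> 81"
  shows "x \<in> {0, 1, 2, 3, 4, 5, 6} \<and> y \<in> {0, 1, 2, 3, 4}"
proof -
  have "(2::int) ^ x * 1 \<le> 2 ^ x * 3 ^ y" "(1::int) * 3 ^ y \<le> 2 ^ x * 3 ^ y"
    by (intro mult_mono; simp)+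
  then have "(2::int) ^ x < 2 ^ 7" "(3::int) ^ y < 3 ^ 5"
    using assms by simp_all
  then have "x < 7" "y < 5"
    by (simp_all only: power_strict_increasing_iff)
  then show ?thesis by auto
qed

theorem theorem1p1:
  "{(n :: nat, x :: nat, y :: nat). (n = 0 \<or> n \<ge> 2) \<and> trib n - 2 ^ x * 3 ^ y = 0}
     = {(2, 0, 0), (3, 1, 0), (4, 2, 0), (7, 3, 1), (9, 0, 4)}"
proof -
  have "(n, x, y) \<in> {(2, 0, 0), (3, 1, 0), (4, 2, 0), (7, 3, 1), (9, 0, 4)}"
    if n: "n = 0 \<or> n \<ge> 2" and eq: "trib n = 2 ^ x * 3 ^ y" for n x y
  proof -
    \<comment> \<open>One of these primes divides each T_n with 2 \<le> n < 22, except for n = 2, 3,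
      4, 7, 9.\<close>
    have not_dvd: "\<not> d dvd trib n" if "d \<in> {5, 7, 11, 13, 103, 137, 149, 5501}" for d
    proof
      assume "d dvd trib n"
      moreover have "coprime d 6"
        using that by (elim insertE emptyE; hypsubst) (code_simp+)
      ultimately have "is_unit d"
        using coprime_6_dvd_smooth eq by metis
      with that show False by auto
    qed
    have "n \<noteq> 0" using eq by (intro notI) simp
    with n trib_smooth_bound[OF eq] have "n \<in> {2..<22}" by simp
    also have "{2..<22} = {2, 3, 4, 5, 6, 7, 8, 9, 10, 11, 12, 13, 14, 15, 16, 17, 18, 19, 20, 21 :: nat}"
      by code_simp
    finally have n_cases: "n \<in> {2, 3, 4, 7, 9}"
      using not_dvd[of 5] not_dvd[of 7] not_dvd[of 11] not_dvd[of 13] not_dvd[of 103]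
        not_dvd[of 137] not_dvd[of 149] not_dvd[of 5501]
      by (elim insertE emptyE; simp add: trib_values)
    then have "trib n \<le> 81"
      by (auto simp: trib_values)
    then have "x \<in> {0, 1, 2, 3, 4, 5, 6}" "y \<in> {0, 1, 2, 3, 4}"
      using smooth_small_cases[OF eq[symmetric]] by blast+
    with n_cases eq show ?thesis
      by (elim insertE emptyE; simp add: trib_values)
  qed
  moreover have "trib n - 2 ^ x * 3 ^ y = 0 \<and> (n = 0 \<or> n \<ge> 2)"
    if "(n, x, y) \<in> {(2, 0, 0), (3, 1, 0), (4, 2, 0), (7, 3, 1), (9, 0, 4)}" for n x y
    using that by (auto simp: trib_values)
  ultimately show ?thesis by auto
qed

end
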